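(* Let $\mathfrak{M}=(V,\langle\cdot,\cdot\rangle,A)$ be a $0$-model of signature $(p,q)$. The following assertions are equivalent: (1) There exists an admissible pair $(r_0,s_0)$ such that $\mathcal{J}(\pi)\mathcal{J}(\pi^\perp)=\mathcal{J}(\pi^\perp)\mathcal{J}(\pi)$ for all $\pi\in \mathrm{Gr}_{r_0,s_0}(V,\langle\cdot,\cdot\rangle)$. (2) $\mathcal{J}(\pi)\mathcal{J}(\pi^\perp)=\mathcal{J}(\pi^\perp)\mathcal{J}(\pi)$ for every non-degenerate subspace $\pi$ of $V$. (3) $[\mathcal{J}(\pi),\rho]=0$ for every non-degenerate subspace $\pi$ of $V$.
   Context: A $0$-model $\mathfrak{M}=(V,\langle\cdot,\cdot\rangle,A)$ consists of a finite dimensional real vector space $V$ of dimension $m=p+q$, a non-degenerate symmetric inner product $\langle\cdot,\cdot\rangle$ on $V$ of signature $(p,q)$ ($p$ timelike, i.e. negative, and $q$ spacelike, i.e. positive, directions), and an algebraic curvature tensor $A\in\otimes^4V^*$, i.e. for all $v_i\in V$: $A(v_1,v_2,v_3,v_4)=A(v_3,v_4,v_1,v_2)=-A(v_2,v_1,v_3,v_4)$ and $A(v_1,v_2,v_3,v_4)+A(v_2,v_3,v_1,v_4)+A(v_3,v_1,v_2,v_4)=0$. The curvature operator $\mathcal{A}$ is defined by $\langle\mathcal{A}(v_1,v_2)v_3,v_4\rangle=A(v_1,v_2,v_3,v_4)$, and the Jacobi operator by $\langle\mathcal{J}(v_1)v_2,v_3\rangle=A(v_2,v_1,v_1,v_3)$,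 i.e. $\mathcal{J}(v)w=\mathcal{A}(w,v)v$. Its polarization is $\mathcal{J}(v_1,v_2)v_3=\frac12\{\mathcal{A}(v_3,v_1)v_2+\mathcal{A}(v_3,v_2)v_1\}$, so $\mathcal{J}(v,v)=\mathcal{J}(v)$. A subspace $\pi\subset V$ is non-degenerate if $\langle\cdot,\cdot\rangle|_\pi$ is non-degenerate; $\pi^\perp$ is its orthogonal complement. If $v_1,\dots,v_k$ is a basis of a non-degenerate $k$-plane $\pi$, put $\xi_{ij}=\langle v_i,v_j\rangle$, let $\xi^{ij}$ be the inverse matrix, and define the higher order Jacobi operator $\mathcal{J}(\pi)=\sum_{i,j=1}^k\xi^{ij}\mathcal{J}(v_i,v_j)$; it is independent of the basis (and $\mathcal{J}(\{0\})=0$). The Ricci operator is $\rho=\mathcal{J}(V)$. $\mathrm{Gr}_{r,s}(V,\langle\cdot,\cdot\rangle)$ is the set of all non-degenerate linear subspaces of $V$ of signature $(r,s)$. The pair $(r,s)$ is admissible if $0\le r\le p$, $0\le s\le q$ and $1\le r+s\le m-1$. $[S,T]=ST-TS$.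
   Formalization: The formal theorem assumes m = p+q ≥ 2; for m ≤ 1 no admissible pair exists, so (1) is false while (2) and (3) hold trivially because A = 0, and the equivalence as stated fails. *)

theory Defs
  imports "HOL-Analysis.Analysis"
begin

text \<open>The vector space \<open>V\<close> is the whole type \<open>'v\<close>; finite-dimensionality is an assumption of
  the locale \<open>zero_model\<close>. The (possibly indefinite) inner product is an explicit form \<open>g\<close>.\<close>

definition nondegenerate_on :: "('v::real_vector \<Rightarrow> 'v \<Rightarrow> real) \<Rightarrow> 'v set \<Rightarrow> bool" where
  "nondegenerate_on g W \<longleftrightarrow> (\<forall>x\<in>W. (\<forall>y\<in>W. g x y = 0) \<longrightarrow> x = 0)"

text \<open>An orthonormal basis of \<open>W\<close> with \<open>r\<close> timelike and \<open>s\<close> spacelike vectors. By Sylvester's law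
  of inertia \<open>r\<close> and \<open>s\<close> are determined by \<open>g\<close> and \<open>W\<close>.\<close>

definition has_signature :: "('v::real_vector \<Rightarrow> 'v \<Rightarrow> real) \<Rightarrow> 'v set \<Rightarrow> nat \<Rightarrow> nat \<Rightarrow> bool" where
  "has_signature g W r s \<longleftrightarrow>
     (\<exists>T S. finite T \<and> finite S \<and> T \<inter> S = {} \<and> card T = r \<and> card S = s \<and>
        independent (T \<union> S) \<and> span (T \<union> S) = W \<and>
        (\<forall>x\<in>T. g x x = - 1) \<and> (\<forall>x\<in>S. g x x = 1) \<and>
        (\<forall>x\<in>T \<union> S. \<forall>y\<in>T \<union> S. x \<noteq> y \<longrightarrow> g x y = 0))"

locale zero_model =
  fixes g :: "'v::real_vector \<Rightarrow> 'v \<Rightarrow> real"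
    and A :: "'v \<Rightarrow> 'v \<Rightarrow> 'v \<Rightarrow> 'v \<Rightarrow> real"
    and p q :: nat
  assumes finite_dimensional: "\<exists>B. finite B \<and> span B = (UNIV :: 'v set)"
    and bilinear_g: "bilinear g"
    and symmetric_g: "g x y = g y x"
    and nondegenerate_g: "nondegenerate_on g UNIV"
    and signature_g: "has_signature g UNIV p q"
    and linear_A1: "linear (\<lambda>x. A x v2 v3 v4)"
    and linear_A2: "linear (\<lambda>x. A v1 x v3 v4)"
    and linear_A3: "linear (\<lambda>x. A v1 v2 x v4)"
    and linear_A4: "linear (\<lambda>x. A v1 v2 v3 x)"
    and pair_symmetry_A: "A v1 v2 v3 v4 = A v3 v4 v1 v2"
    and antisymmetry_A: "A v1 v2 v3 v4 = - A v2 v1 v3 v4"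
    and bianchi_A: "A v1 v2 v3 v4 + A v2 v3 v1 v4 + A v3 v1 v2 v4 = 0"

definition curvature_operator ::
  "('v::real_vector \<Rightarrow> 'v \<Rightarrow> real) \<Rightarrow> ('v \<Rightarrow> 'v \<Rightarrow> 'v \<Rightarrow> 'v \<Rightarrow> real) \<Rightarrow> 'v \<Rightarrow> 'v \<Rightarrow> 'v \<Rightarrow> 'v" where
  "curvature_operator g A v1 v2 v3 = (THE w. \<forall>v4. g w v4 = A v1 v2 v3 v4)"

definition jacobi_polarized ::
  "('v::real_vector \<Rightarrow> 'v \<Rightarrow> real) \<Rightarrow> ('v \<Rightarrow> 'v \<Rightarrow> 'v \<Rightarrow> 'v \<Rightarrow> real) \<Rightarrow> 'v \<Rightarrow> 'v \<Rightarrow> 'v \<Rightarrow> 'v" where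
  "jacobi_polarized g A v1 v2 v3 =
     (1/2) *\<^sub>R (curvature_operator g A v3 v1 v2 + curvature_operator g A v3 v2 v1)"

text \<open>The Gram matrix of a finite set \<open>B\<close> is indexed by the vectors of \<open>B\<close> themselves; its inverse
  is unique on \<open>B \<times> B\<close>, and its values elsewhere are never used.\<close>

definition gram_inverse :: "('v::real_vector \<Rightarrow> 'v \<Rightarrow> real) \<Rightarrow> 'v set \<Rightarrow> 'v \<Rightarrow> 'v \<Rightarrow> real" where
  "gram_inverse g B = (SOME M. \<forall>a\<in>B. \<forall>c\<in>B.
     (\<Sum>b\<in>B. M a b * g b c) = (if a = c then 1 else 0) \<and>
     (\<Sum>b\<in>B. g a b * M b c) = (if a = c then 1 else 0))"

definition higher_jacobi_basis ::
  "('v::real_vector \<Rightarrow> 'v \<Rightarrow> real) \<Rightarrow> ('v \<Rightarrow> 'v \<Rightarrow> 'v \<Rightarrow> 'v \<Rightarrow> real) \<Rightarrow> 'v set \<Rightarrow> 'v \<Rightarrow> 'v" where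
  "higher_jacobi_basis g A B w =
     (\<Sum>a\<in>B. \<Sum>b\<in>B. gram_inverse g B a b *\<^sub>R jacobi_polarized g A a b w)"

text \<open>For a non-degenerate subspace the value does not depend on the chosen basis; for \<open>{0}\<close> the
  basis is empty and the operator is zero.\<close>

definition higher_jacobi ::
  "('v::real_vector \<Rightarrow> 'v \<Rightarrow> real) \<Rightarrow> ('v \<Rightarrow> 'v \<Rightarrow> 'v \<Rightarrow> 'v \<Rightarrow> real) \<Rightarrow> 'v set \<Rightarrow> 'v \<Rightarrow> 'v" where
  "higher_jacobi g A W =
     higher_jacobi_basis g A (SOME B. finite B \<and> independent B \<and> span B = W)"

definition ricci_operator ::
  "('v::real_vector \<Rightarrow> 'v \<Rightarrow> real) \<Rightarrow> ('v \<Rightarrow> 'v \<Rightarrow> 'v \<Rightarrow> 'v \<Rightarrow> real) \<Rightarrow> 'v \<Rightarrow> 'v" where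
  "ricci_operator g A = higher_jacobi g A UNIV"

definition orth_compl :: "('v::real_vector \<Rightarrow> 'v \<Rightarrow> real) \<Rightarrow> 'v set \<Rightarrow> 'v set" where
  "orth_compl g W = {x. \<forall>y\<in>W. g x y = 0}"

definition nondegenerate_subspaces :: "('v::real_vector \<Rightarrow> 'v \<Rightarrow> real) \<Rightarrow> 'v set set" where
  "nondegenerate_subspaces g = {W. subspace W \<and> nondegenerate_on g W}"

definition Gr :: "('v::real_vector \<Rightarrow> 'v \<Rightarrow> real) \<Rightarrow> nat \<Rightarrow> nat \<Rightarrow> 'v set set" where
  "Gr g r s = {W \<in> nondegenerate_subspaces g. has_signature g W r s}"

definition admissible :: "nat \<Rightarrow> nat \<Rightarrow> nat \<Rightarrow> nat \<Rightarrow> bool" where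
  "admissible p q r s \<longleftrightarrow> r \<le> p \<and> s \<le> q \<and> 1 \<le> r + s \<and> r + s \<le> (p + q) - 1"

definition commutator :: "('v::real_vector \<Rightarrow> 'v) \<Rightarrow> ('v \<Rightarrow> 'v) \<Rightarrow> 'v \<Rightarrow> 'v" where
  "commutator S T = (\<lambda>x. S (T x) - T (S x))"

end

theory Submission
  imports Defs
begin

text \<open>Three facts carry the proof.

  First, \<open>J(\<pi>) + J(\<pi>\<^sup>\<bottom>) = \<rho>\<close> for every non-degenerate \<open>\<pi>\<close>. A higher order Jacobi operator is the trace, with
  respect to the metric on \<open>\<pi>\<close>, of the bilinear map \<open>(x, y) \<mapsto> J(x, y)\<close>; such a trace can be computed
  in an orthonormal basis (\<open>gram_trace_orthonormal\<close>), and orthonormal bases of \<open>\<pi>\<close> and \<open>\<pi>\<^sup>\<bottom>\<close> together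
  form one of \<open>V\<close> (\<open>adapted_orthonormal_basis\<close>). So \<open>J(\<pi>)\<close> commutes with \<open>J(\<pi>\<^sup>\<bottom>)\<close> exactly when it
  commutes with \<open>\<rho>\<close>. This is the equivalence of (2) and (3), and it turns (1) into the statement
  that \<open>[J(\<pi>), \<rho>] = 0\<close> for all \<open>\<pi>\<close> of one signature.

  Second, for a fixed vector \<open>w\<close> the map \<open>F(x, y) = [J(x, y), \<rho>] w\<close> is bilinear and symmetric, its
  trace over each \<open>\<pi>\<close> in \<open>Gr(r,s)\<close> vanishes by (1), and its trace over \<open>V\<close> is \<open>[\<rho>, \<rho>] w = 0\<close>.

  Third, such an \<open>F\<close> is zero (\<open>bilinear_vanishes_of_partial_traces\<close>). Let \<open>e\<close> and \<open>f\<close> be two members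
  of an orthonormal basis, \<open>e\<close> in \<open>\<pi>\<close> and \<open>f\<close> in \<open>\<pi>\<^sup>\<bottom>\<close>, and rotate (equal signs) or boost (opposite
  signs) in their plane. The new \<open>\<pi>\<close> has the same signature, and comparison of the two traces gives
  \<open>F(e', e') = F(e, e)\<close>. Expanding this for two opposite angles yields
  \<open>g(e, e) F(e, e) = g(f, f) F(f, f)\<close> and \<open>F(e, f) = 0\<close>. Since \<open>\<pi>\<close> and \<open>\<pi>\<^sup>\<bottom>\<close> are both nonzero, the
  values \<open>g(e, e) F(e, e)\<close> agree for all basis vectors, and as they sum to zero they all vanish. This
  holds in every orthonormal basis, so one more rotation or boost gives \<open>F(e, f) = 0\<close> for any two basis
  vectors. Hence every \<open>J(x, y)\<close> commutes with \<open>\<rho>\<close>, and so does \<open>J(\<pi>)\<close> for every \<open>\<pi>\<close>.\<close>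

section \<open>Orthonormal families in a symmetric bilinear form\<close>

text \<open>The vectors are indexed so that the signs \<open>\<epsilon>\<close>, and with them the signature of each subfamily, stay
  literally the same when the vectors are replaced by others.\<close>
definition orthonormal_family ::
  "('v::real_vector \<Rightarrow> 'v \<Rightarrow> real) \<Rightarrow> 'i set \<Rightarrow> ('i \<Rightarrow> real) \<Rightarrow> ('i \<Rightarrow> 'v) \<Rightarrow> bool" where
  "orthonormal_family g I \<epsilon> b \<longleftrightarrow> finite I \<and> (\<forall>i\<in>I. \<epsilon> i = 1 \<or> \<epsilon> i = - 1) \<and>
     (\<forall>i\<in>I. \<forall>j\<in>I. g (b i) (b j) = (if i = j then \<epsilon> i else 0))"

lemma orthonormal_familyD:
  assumes "orthonormal_family g I \<epsilon> b"
  shows "finite I" and "i \<in> I \<Longrightarrow> \<epsilon> i * \<epsilon> i = 1" and "i \<in> I \<Longrightarrow> \<epsilon> i \<noteq> 0"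
    and "i \<in> I \<Longrightarrow> j \<in> I \<Longrightarrow> g (b i) (b j) = (if i = j then \<epsilon> i else 0)"
  using assms unfolding orthonormal_family_def by force+

lemma orthonormal_family_subset:
  "orthonormal_family g I \<epsilon> b \<Longrightarrow> J \<subseteq> I \<Longrightarrow> orthonormal_family g J \<epsilon> b"
  unfolding orthonormal_family_def by (blast intro: finite_subset)

locale symmetric_form =
  fixes g :: "'v::real_vector \<Rightarrow> 'v \<Rightarrow> real"
  assumes bilinear_form: "bilinear g"
    and form_commute: "g x y = g y x"
begin

lemma form_simps:
  "g (x + y) z = g x z + g y z" "g x (y + z) = g x y + g x z"
  "g (x - y) z = g x z - g y z" "g x (y - z) = g x y - g x z"
  "g (c *\<^sub>R x) y = c * g x y" "g x (c *\<^sub>R y) = c * g x y"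
  "g 0 y = 0" "g x 0 = 0"
  using bilinear_form
  by (simp_all add: bilinear_ladd bilinear_radd bilinear_lsub bilinear_rsub
      bilinear_lmul bilinear_rmul bilinear_lzero bilinear_rzero)

lemma linear_form_left: "linear (\<lambda>x. g x y)" and linear_form_right: "linear (g x)"
  using bilinear_form by (auto simp: bilinear_def)

lemma form_sum: "g (\<Sum>i\<in>I. f i) y = (\<Sum>i\<in>I. g (f i) y)" "g x (\<Sum>i\<in>I. f i) = (\<Sum>i\<in>I. g x (f i))"
  using linear_sum[OF linear_form_left] linear_sum[OF linear_form_right] by auto

lemma orthonormal_expansion:
  assumes on: "orthonormal_family g I \<epsilon> b" and x: "x \<in> span (b ` I)"
  shows "(\<Sum>i\<in>I. (\<epsilon> i * g x (b i)) *\<^sub>R b i) = x"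
proof -
  have lin: "linear (\<lambda>x. \<Sum>i\<in>I. (\<epsilon> i * g x (b i)) *\<^sub>R b i)"
    by (rule linearI)
       (simp_all add: form_simps algebra_simps sum.distrib scaleR_sum_right)
  have "(\<Sum>i\<in>I. (\<epsilon> i * g y (b i)) *\<^sub>R b i) = y" if y: "y \<in> b ` I" for y
  proof -
    from y obtain j where j: "j \<in> I" "y = b j" by auto
    have "(\<Sum>i\<in>I. (\<epsilon> i * g y (b i)) *\<^sub>R b i) = (\<Sum>i\<in>I. if j = i then b i else 0)"
      using on j by (intro sum.cong) (auto simp: orthonormal_familyD[OF on])
    then show ?thesis using j orthonormal_familyD(1)[OF on] by simp
  qed
  then show ?thesis
    using linear_eq_on_span[OF lin linear_ident, of "b ` I" x] x by auto
qed

lemma orthonormal_inj: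
  assumes on: "orthonormal_family g I \<epsilon> b" shows "inj_on b I"
proof (rule inj_onI, rule ccontr)
  fix i j assume "i \<in> I" "j \<in> I" "b i = b j" "i \<noteq> j"
  then show False using orthonormal_familyD[OF on] by metis
qed

lemma orthonormal_independent:
  assumes on: "orthonormal_family g I \<epsilon> b" shows "independent (b ` I)"
  unfolding dependent_def
proof (intro notI, elim bexE)
  fix a assume "a \<in> b ` I" and a: "a \<in> span (b ` I - {a})"
  then obtain i where i: "i \<in> I" "a = b i" by auto
  have "b ` I - {a} = b ` (I - {i})"
    using i inj_onD[OF orthonormal_inj[OF on]] by auto
  with a i have "b i \<in> span (b ` (I - {i}))" by simp
  from orthonormal_expansion[OF orthonormal_family_subset[OF on] this]
  have "b i = (\<Sum>j\<in>I - {i}. (\<epsilon> j * g (b i) (b j)) *\<^sub>R b j)" by auto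
  also have "\<dots> = 0"
    using i by (intro sum.neutral) (auto simp: orthonormal_familyD[OF on])
  finally show False
    using orthonormal_familyD(3,4)[OF on] i form_simps(7) by metis
qed

text \<open>Subtracting the expansion along an orthonormal family is the projection onto its orthogonal
  complement, so an orthonormal basis of a subspace splits it off as a direct summand.\<close>
lemma projection_orthogonal:
  assumes on: "orthonormal_family g I \<epsilon> b" and y: "y \<in> span (b ` I)"
  shows "g (x - (\<Sum>i\<in>I. (\<epsilon> i * g x (b i)) *\<^sub>R b i)) y = 0"
proof -
  let ?u = "x - (\<Sum>i\<in>I. (\<epsilon> i * g x (b i)) *\<^sub>R b i)"
  have basis: "g ?u (b j) = 0" if j: "j \<in> I" for j
  proof -
    have "(\<Sum>i\<in>I. (\<epsilon> i * g x (b i)) * g (b i) (b j)) = (\<Sum>i\<in>I. if j = i then g x (b i) else 0)"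
      using j by (intro sum.cong) (auto simp: orthonormal_familyD[OF on])
    then show ?thesis
      using j orthonormal_familyD(1)[OF on] by (simp add: form_simps form_sum)
  qed
  then show ?thesis
    using linear_eq_on_span[OF linear_form_right[of ?u] linear_zero, of "b ` I" y] y
    by auto
qed

lemma isotropic_subspace_orthogonal:
  assumes U: "subspace U" and iso: "\<And>u. u \<in> U \<Longrightarrow> g u u = 0" and u: "u \<in> U" "v \<in> U"
  shows "g u v = 0"
proof -
  have "g (u + v) (u + v) = 0" using U u by (intro iso) (rule subspace_add)
  then show ?thesis using iso[OF u(1)] iso[OF u(2)] form_commute[of u v] by (simp add: form_simps)
qed

text \<open>A largest orthonormal subset \<open>S\<close> of \<open>W\<close> spans \<open>W\<close>. By maximality, the part \<open>U\<close> of \<open>W\<close> orthogonal to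
  \<open>S\<close> contains no vector with \<open>g u u \<noteq> 0\<close>, so by polarization it is orthogonal to itself. It is then
  orthogonal to all of \<open>W = span S + U\<close> and hence zero.\<close>
lemma orthonormal_basis_exists:
  assumes fin: "finite (C :: 'v set)" "span C = UNIV"
    and W: "subspace W" "nondegenerate_on g W"
  obtains S where "orthonormal_family g S (\<lambda>x. g x x) (\<lambda>x. x)" "span S = W"
proof -
  let ?P = "\<lambda>S. orthonormal_family g S (\<lambda>x. g x x) (\<lambda>x. x) \<and> S \<subseteq> W"
  have bound: "card S < Suc (card C)" if "?P S" for S
    using independent_span_bound[OF fin(1), of S] orthonormal_independent[of S] that fin(2)
    by fastforce
  have "?P {}" by (simp add: orthonormal_family_def)
  from ex_has_greatest_nat[of ?P, OF this, of card "Suc (card C)"] bound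
  obtain S where S: "?P S" and max: "\<And>S'. ?P S' \<Longrightarrow> card S' \<le> card S"
    by (metis less_imp_le)
  have on: "orthonormal_family g S (\<lambda>x. g x x) (\<lambda>x. x)" and SW: "S \<subseteq> W" using S by auto
  define U where "U = W \<inter> orth_compl g S"
  have subU: "subspace U"
    using W(1) by (auto simp: U_def orth_compl_def subspace_def form_simps)
  have iso: "g u u = 0" if u: "u \<in> U" for u
  proof (rule ccontr)
    assume nz: "g u u \<noteq> 0"
    define v where "v = (1 / sqrt \<bar>g u u\<bar>) *\<^sub>R u"
    have "g v v = g u u / (sqrt \<bar>g u u\<bar> * sqrt \<bar>g u u\<bar>)" by (simp add: v_def form_simps)
    also have "\<dots> = g u u / \<bar>g u u\<bar>" by simp
    finally have gv: "g v v = 1 \<or> g v v = - 1"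
      using nz by (cases "g u u > 0") auto
    have vU: "v \<in> U" unfolding v_def using subU u by (rule subspace_scale)
    then have vS: "\<And>y. y \<in> S \<Longrightarrow> g v y = 0" and "v \<in> W" by (auto simp: U_def orth_compl_def)
    have sv: "\<And>y. y \<in> S \<Longrightarrow> g y v = 0"
      by (subst form_commute) (rule vS)
    have "g v v \<noteq> 0" using gv by (elim disjE) simp_all
    then have "v \<notin> S" using vS by blast
    moreover have "orthonormal_family g (insert v S) (\<lambda>x. g x x) (\<lambda>x. x)"
      unfolding orthonormal_family_def
    proof (intro conjI ballI)
      show "finite (insert v S)" using orthonormal_familyD(1)[OF on] by simp
    next
      fix x assume "x \<in> insert v S"
      then show "g x x = 1 \<or> g x x = - 1"
        using on gv unfolding orthonormal_family_def by blast
    next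
      fix x y assume "x \<in> insert v S" "y \<in> insert v S"
      then show "g x y = (if x = y then g x x else 0)"
        using orthonormal_familyD(4)[OF on, of x y] vS[of y] sv[of x] by (cases "x = y") auto
    qed
    ultimately show False
      using max[of "insert v S"] orthonormal_familyD(1)[OF on] SW \<open>v \<in> W\<close> by simp
  qed
  have "W \<subseteq> span S"
  proof
    fix x assume x: "x \<in> W"
    define s where "s = (\<Sum>i\<in>S. (g i i * g x i) *\<^sub>R i)"
    have sum_in: "(\<Sum>i\<in>S. (g i i * g y i) *\<^sub>R i) \<in> span S" for y
      by (intro span_sum span_scale span_base)
    have spanW: "span S \<subseteq> W" using SW W(1) by (rule span_minimal)
    have residual: "y - (\<Sum>i\<in>S. (g i i * g y i) *\<^sub>R i) \<in> U" if "y \<in> W" for y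
      using projection_orthogonal[OF on, of _ y] that sum_in[of y] spanW W(1)
      by (auto simp: U_def orth_compl_def intro!: subspace_diff span_base)
    have u: "x - s \<in> U" unfolding s_def by (rule residual[OF x])
    have "g (x - s) y = 0" if y: "y \<in> W" for y
    proof -
      let ?t = "\<Sum>i\<in>S. (g i i * g y i) *\<^sub>R i"
      have "g (x - s) (y - ?t) = 0"
        using isotropic_subspace_orthogonal[OF subU iso u residual[OF y]] .
      moreover have "g (x - s) ?t = 0"
        using projection_orthogonal[OF on, of ?t x] sum_in[of y] by (simp add: s_def)
      ultimately show ?thesis by (simp add: form_simps)
    qed
    moreover have "x - s \<in> W" using u by (simp add: U_def)
    ultimately have "x - s = 0" using W(2) by (auto simp: nondegenerate_on_def)
    then show "x \<in> span S" using sum_in[of x] by (simp add: s_def)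
  qed
  then have "span S = W" using SW W(1) by (simp add: span_minimal subset_antisym)
  with on show ?thesis using that by blast
qed

lemma subspace_orth_compl: "subspace (orth_compl g W)"
  by (auto simp: orth_compl_def subspace_def form_simps)

text \<open>Projection along an orthonormal basis of \<open>W\<close> gives \<open>V = W + W\<^sup>\<bottom>\<close>. A vector of \<open>W\<^sup>\<bottom>\<close> orthogonal to
  \<open>W\<^sup>\<bottom>\<close> is then orthogonal to \<open>V\<close>, so \<open>W\<^sup>\<bottom>\<close> is non-degenerate and has an orthonormal basis too.\<close>
lemma adapted_orthonormal_basis:
  assumes fin: "finite (C :: 'v set)" "span C = UNIV" and nd: "nondegenerate_on g UNIV"
    and W: "W \<in> nondegenerate_subspaces g"
  obtains S T where "orthonormal_family g (S \<union> T) (\<lambda>x. g x x) (\<lambda>x. x)" "S \<inter> T = {}"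
    "span S = W" "span T = orth_compl g W" "span (S \<union> T) = UNIV"
proof -
  have W': "subspace W" "nondegenerate_on g W"
    using W by (auto simp: nondegenerate_subspaces_def)
  obtain S where S: "orthonormal_family g S (\<lambda>x. g x x) (\<lambda>x. x)" "span S = W"
    using orthonormal_basis_exists[OF fin W'] .
  have split: "\<exists>s\<in>W. x - s \<in> orth_compl g W" for x
  proof
    show "(\<Sum>i\<in>S. (g i i * g x i) *\<^sub>R i) \<in> W"
      unfolding S(2)[symmetric] by (intro span_sum span_scale span_base)
    show "x - (\<Sum>i\<in>S. (g i i * g x i) *\<^sub>R i) \<in> orth_compl g W"
      using projection_orthogonal[OF S(1), of _ x] S(2) by (auto simp: orth_compl_def)
  qed
  have "nondegenerate_on g (orth_compl g W)"
    unfolding nondegenerate_on_def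
  proof (intro ballI impI)
    fix x assume x: "x \<in> orth_compl g W" "\<forall>y\<in>orth_compl g W. g x y = 0"
    have "g x y = 0" for y
    proof -
      obtain s where "s \<in> W" "y - s \<in> orth_compl g W" using split by blast
      then have "g x s = 0" "g x (y - s) = 0" using x by (auto simp: orth_compl_def)
      then show ?thesis by (simp add: form_simps)
    qed
    then show "x = 0" using nd by (auto simp: nondegenerate_on_def)
  qed
  then obtain T where T: "orthonormal_family g T (\<lambda>x. g x x) (\<lambda>x. x)" "span T = orth_compl g W"
    using orthonormal_basis_exists[OF fin subspace_orth_compl] by blast
  have TS: "g t s = 0" "g s t = 0" if "t \<in> T" "s \<in> S" for s t
  proof -
    have "t \<in> orth_compl g W" "s \<in> W" using that S(2) T(2) span_base by blast+
    then show "g t s = 0" by (simp add: orth_compl_def)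
    then show "g s t = 0" using form_commute by metis
  qed
  have disj: "S \<inter> T = {}"
    using TS orthonormal_familyD(3)[OF S(1)] by blast
  have "orthonormal_family g (S \<union> T) (\<lambda>x. g x x) (\<lambda>x. x)"
    unfolding orthonormal_family_def
  proof (intro conjI ballI)
    show "finite (S \<union> T)" using orthonormal_familyD(1) S(1) T(1) by blast
  next
    fix x assume "x \<in> S \<union> T"
    then show "g x x = 1 \<or> g x x = - 1"
      using S(1) T(1) by (auto simp: orthonormal_family_def)
  next
    fix x y assume "x \<in> S \<union> T" "y \<in> S \<union> T"
    then show "g x y = (if x = y then g x x else 0)"
      using orthonormal_familyD(4)[OF S(1)] orthonormal_familyD(4)[OF T(1)] TS disj by auto
  qed
  moreover have "x \<in> span (S \<union> T)" for x
  proof -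
    obtain s where s: "s \<in> span S" "x - s \<in> span T" using split S(2) T(2) by blast
    then have "s \<in> span (S \<union> T)" "x - s \<in> span (S \<union> T)"
      using span_mono[of S "S \<union> T"] span_mono[of T "S \<union> T"] by auto
    then have "s + (x - s) \<in> span (S \<union> T)" by (rule span_add)
    then show ?thesis by simp
  qed
  ultimately show ?thesis using that disj S(2) T(2) by blast
qed

section \<open>The metric trace of a bilinear map\<close>

text \<open>If \<open>R\<close> holds the coordinates of an orthonormal basis in the basis \<open>B\<close>, the inverse Gram matrix is
  \<open>R \<epsilon> R\<^sup>T\<close>. This matrix, \<open>N\<close> in the proof, is a two-sided inverse, which also shows that the choice
  in \<open>gram_inverse\<close> has a witness. Any other inverse \<open>M\<close> equals it because \<open>M = M (G N) = (M G) N = N\<close>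
  for the Gram matrix \<open>G\<close>.\<close>
lemma gram_inverse_eq:
  assumes on: "orthonormal_family g I \<epsilon> b"
    and B: "finite B" "independent B" "span B = span (b ` I)"
    and ac: "a \<in> B" "c \<in> B"
  shows "gram_inverse g B a c =
    (\<Sum>i\<in>I. \<epsilon> i * representation B (b i) a * representation B (b i) c)"
proof -
  let ?r = "\<lambda>i. representation B (b i)"
  define N where "N a c = (\<Sum>i\<in>I. \<epsilon> i * ?r i a * ?r i c)" for a c
  have bI: "b i \<in> span B" if "i \<in> I" for i using that B(3) by (simp add: span_base)
  have expand: "(\<Sum>c\<in>B. ?r i c * g c d) = g (b i) d" if "i \<in> I" for i d
  proof -
    have "(\<Sum>c\<in>B. ?r i c * g c d) = g (\<Sum>c\<in>B. ?r i c *\<^sub>R c) d"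
      by (simp add: form_sum form_simps)
    then show ?thesis
      using sum_representation_eq[OF B(2) bI[OF that] B(1)] by simp
  qed
  have NG: "(\<Sum>c\<in>B. N a c * g c d) = (if a = d then 1 else 0)" if "a \<in> B" "d \<in> B" for a d
  proof -
    have d: "d \<in> span (b ` I)" using that B(3) span_base by auto
    have "(\<Sum>c\<in>B. N a c * g c d) = (\<Sum>c\<in>B. \<Sum>i\<in>I. \<epsilon> i * ?r i a * (?r i c * g c d))"
      unfolding N_def sum_distrib_right by (simp add: mult.assoc)
    also have "\<dots> = (\<Sum>i\<in>I. \<epsilon> i * ?r i a * (\<Sum>c\<in>B. ?r i c * g c d))"
      by (subst sum.swap) (simp add: sum_distrib_left)
    also have "\<dots> = (\<Sum>i\<in>I. representation B ((\<epsilon> i * g d (b i)) *\<^sub>R b i) a)"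
      using form_commute[of d "b _"]
      by (intro sum.cong) (simp_all add: expand representation_scale[OF B(2)] bI)
    also have "\<dots> = representation B (\<Sum>i\<in>I. (\<epsilon> i * g d (b i)) *\<^sub>R b i) a"
      by (subst representation_sum[OF B(2)]) (auto intro!: span_scale bI)
    also have "\<dots> = (if a = d then 1 else 0)"
      using orthonormal_expansion[OF on d] representation_basis[OF B(2)] that by auto
    finally show ?thesis .
  qed
  have GN: "(\<Sum>c\<in>B. g a c * N c d) = (if a = d then 1 else 0)" if "a \<in> B" "d \<in> B" for a d
  proof -
    have "(\<Sum>c\<in>B. g a c * N c d) = (\<Sum>c\<in>B. N d c * g c a)"
      by (intro sum.cong refl) (simp add: N_def form_commute[of a] mult_ac)
    then show ?thesis using NG[OF that(2,1)] by auto
  qed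
  define M where "M = gram_inverse g B"
  have spec: "\<forall>a\<in>B. \<forall>c\<in>B. (\<Sum>b\<in>B. M a b * g b c) = (if a = c then 1 else 0) \<and>
     (\<Sum>b\<in>B. g a b * M b c) = (if a = c then 1 else 0)"
    unfolding M_def gram_inverse_def by (rule someI[of _ N]) (simp add: NG GN)
  have "M a c = (\<Sum>d\<in>B. M a d * (if d = c then 1 else 0))"
    using ac B(1) by (simp add: if_distrib[of "\<lambda>x. _ * x"] cong: if_cong)
  also have "\<dots> = (\<Sum>d\<in>B. M a d * (\<Sum>k\<in>B. g d k * N k c))"
    using ac by (intro sum.cong) (auto simp: GN)
  also have "\<dots> = (\<Sum>k\<in>B. (\<Sum>d\<in>B. M a d * g d k) * N k c)"
    unfolding sum_distrib_left sum_distrib_right by (subst sum.swap) (simp add: mult.assoc)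
  also have "\<dots> = (\<Sum>k\<in>B. (if a = k then 1 else 0) * N k c)"
    using ac spec by (intro sum.cong) auto
  also have "\<dots> = N a c"
    using ac B(1) by (simp add: if_distrib[of "\<lambda>x. x * _"] cong: if_cong)
  finally show ?thesis by (simp add: M_def N_def)
qed

text \<open>This makes the higher order Jacobi operator independent of the basis chosen in its definition:
  each of the two sides depends on only one of the bases \<open>B\<close> and \<open>b\<close>.\<close>
lemma gram_trace_orthonormal:
  fixes F :: "'v \<Rightarrow> 'v \<Rightarrow> 'u::real_vector"
  assumes F: "bilinear F" and on: "orthonormal_family g I \<epsilon> b"
    and B: "finite B" "independent B" "span B = span (b ` I)"
  shows "(\<Sum>a\<in>B. \<Sum>c\<in>B. gram_inverse g B a c *\<^sub>R F a c) = (\<Sum>i\<in>I. \<epsilon> i *\<^sub>R F (b i) (b i))"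
proof -
  let ?r = "\<lambda>i. representation B (b i)"
  interpret l: linear "\<lambda>x. F x y" for y using F by (simp add: bilinear_def)
  interpret r: linear "F x" for x using F by (simp add: bilinear_def)
  have eq: "F (b i) (b i) = (\<Sum>a\<in>B. \<Sum>c\<in>B. (?r i a * ?r i c) *\<^sub>R F a c)" if "i \<in> I" for i
  proof -
    have "b i \<in> span B" using that B(3) by (simp add: span_base)
    then have "b i = (\<Sum>a\<in>B. ?r i a *\<^sub>R a)"
      using sum_representation_eq[OF B(2) _ B(1)] by simp
    then have "F (b i) (b i) = F (\<Sum>a\<in>B. ?r i a *\<^sub>R a) (\<Sum>c\<in>B. ?r i c *\<^sub>R c)" by simp
    also have "\<dots> = (\<Sum>a\<in>B. \<Sum>c\<in>B. (?r i a * ?r i c) *\<^sub>R F a c)"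
      by (subst l.sum, subst r.sum) (simp add: l.scale r.scale mult.commute)
    finally show ?thesis .
  qed
  have "(\<Sum>a\<in>B. \<Sum>c\<in>B. gram_inverse g B a c *\<^sub>R F a c) =
      (\<Sum>a\<in>B. \<Sum>c\<in>B. \<Sum>i\<in>I. \<epsilon> i *\<^sub>R (?r i a * ?r i c) *\<^sub>R F a c)"
    by (intro sum.cong) (auto simp: gram_inverse_eq[OF on B] scaleR_sum_left mult.assoc)
  also have "\<dots> = (\<Sum>a\<in>B. \<Sum>i\<in>I. \<Sum>c\<in>B. \<epsilon> i *\<^sub>R (?r i a * ?r i c) *\<^sub>R F a c)"
    by (intro sum.cong refl sum.swap)
  also have "\<dots> = (\<Sum>i\<in>I. \<Sum>a\<in>B. \<Sum>c\<in>B. \<epsilon> i *\<^sub>R (?r i a * ?r i c) *\<^sub>R F a c)"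
    by (rule sum.swap)
  also have "\<dots> = (\<Sum>i\<in>I. \<epsilon> i *\<^sub>R F (b i) (b i))"
    by (intro sum.cong) (auto simp: eq scaleR_sum_right)
  finally show ?thesis .
qed

end

section \<open>Bilinear maps with vanishing partial traces\<close>

text \<open>Rational points on the circle (\<open>\<sigma> = 1\<close>) and on the hyperbola (\<open>\<sigma> = - 1\<close>), obtained from the
  Pythagorean triple 3, 4, 5.\<close>
lemma rotation_or_boost_parameters:
  fixes \<sigma> :: real
  assumes "\<sigma> = 1 \<or> \<sigma> = - 1"
  obtains a c :: real where "a * a + \<sigma> * c * c = 1" "a \<noteq> 0" "c \<noteq> 0"
proof (cases "\<sigma> = 1")
  case True
  then show ?thesis by (intro that[of "3/5" "4/5"]) auto
next
  case False
  then show ?thesis using assms by (intro that[of "5/4" "3/4"]) auto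
qed

context symmetric_form
begin

text \<open>A rotation in the plane of \<open>b i\<close> and \<open>b j\<close> if their signs agree, a boost if they differ: the factor
  \<open>\<epsilon> i * \<epsilon> j\<close> treats both cases at once.\<close>
lemma orthonormal_rotate:
  assumes on: "orthonormal_family g I \<epsilon> b" and ij: "i \<in> I" "j \<in> I" "i \<noteq> j"
    and ac: "a * a + \<epsilon> i * \<epsilon> j * c * c = 1"
  defines "b' \<equiv> b(i := a *\<^sub>R b i + c *\<^sub>R b j, j := a *\<^sub>R b j - (\<epsilon> i * \<epsilon> j * c) *\<^sub>R b i)"
  shows "orthonormal_family g I \<epsilon> b'" and "span (b ` I) \<subseteq> span (b' ` I)"
proof -
  note gb = orthonormal_familyD(4)[OF on]
  have b'i: "b' i = a *\<^sub>R b i + c *\<^sub>R b j" and b'j: "b' j = a *\<^sub>R b j - (\<epsilon> i * \<epsilon> j * c) *\<^sub>R b i"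
    and b'k: "\<And>k. k \<noteq> i \<Longrightarrow> k \<noteq> j \<Longrightarrow> b' k = b k"
    using ij(3) by (auto simp: b'_def)
  have ei: "\<epsilon> i = 1 \<or> \<epsilon> i = - 1" and ej: "\<epsilon> j = 1 \<or> \<epsilon> j = - 1"
    using on ij by (auto simp: orthonormal_family_def)
  have ii: "g (b' i) (b' i) = \<epsilon> i"
    using ac ij ei ej by (auto simp: b'i form_simps gb algebra_simps)
  have jj: "g (b' j) (b' j) = \<epsilon> j"
    using ac ij ei ej by (auto simp: b'j form_simps gb algebra_simps)
  have ij0: "g (b' i) (b' j) = 0"
    using ij ei ej by (auto simp: b'i b'j form_simps gb algebra_simps)
  then have ji0: "g (b' j) (b' i) = 0" by (subst form_commute)
  have k0: "g (b' k) (b' i) = 0" "g (b' k) (b' j) = 0" "g (b' i) (b' k) = 0" "g (b' j) (b' k) = 0"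
    if "k \<in> I" "k \<noteq> i" "k \<noteq> j" for k
    using that ij by (auto simp: b'i b'j b'k form_simps gb)
  show "orthonormal_family g I \<epsilon> b'"
    unfolding orthonormal_family_def
  proof (intro conjI ballI)
    show "finite I" by (rule orthonormal_familyD(1)[OF on])
    show "\<epsilon> k = 1 \<or> \<epsilon> k = - 1" if "k \<in> I" for k
      using on that by (auto simp: orthonormal_family_def)
    show "g (b' k) (b' l) = (if k = l then \<epsilon> k else 0)" if kl: "k \<in> I" "l \<in> I" for k l
      using kl ii jj ij0 ji0 k0[of k] k0[of l] gb[OF kl] b'k[of k] b'k[of l]
      by (cases "k = i"; cases "k = j"; cases "l = i"; cases "l = j") auto
  qed
  have "b k \<in> span (b' ` I)" if k: "k \<in> I" for k
  proof -
    have b'span: "\<And>k. k \<in> I \<Longrightarrow> b' k \<in> span (b' ` I)" by (auto intro: span_base)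
    have "a *\<^sub>R b' i - c *\<^sub>R b' j = (a * a + \<epsilon> i * \<epsilon> j * c * c) *\<^sub>R b i"
      by (simp add: b'i b'j algebra_simps)
    then have "b i = a *\<^sub>R b' i - c *\<^sub>R b' j" using ac by simp
    then have bi: "b i \<in> span (b' ` I)"
      using ij b'span by (metis span_diff span_scale)
    have "(\<epsilon> i * \<epsilon> j * c) *\<^sub>R b' i + a *\<^sub>R b' j = (a * a + \<epsilon> i * \<epsilon> j * c * c) *\<^sub>R b j"
      by (simp add: b'i b'j algebra_simps)
    then have "b j = (\<epsilon> i * \<epsilon> j * c) *\<^sub>R b' i + a *\<^sub>R b' j" using ac by simp
    then have bj: "b j \<in> span (b' ` I)"
      using ij b'span by (metis span_add span_scale)
    show ?thesis using bi bj b'span[OF k] b'k[of k] by (cases "k = i"; cases "k = j") auto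
  qed
  then show "span (b ` I) \<subseteq> span (b' ` I)" by (intro span_minimal) auto
qed

text \<open>The new \<open>i\<close>-th vectors \<open>a b\<^sub>i \<plusminus> c b\<^sub>j\<close> give
  \<open>a\<^sup>2 F(b\<^sub>i, b\<^sub>i) \<plusminus> 2 a c F(b\<^sub>i, b\<^sub>j) + c\<^sup>2 F(b\<^sub>j, b\<^sub>j) = F(b\<^sub>i, b\<^sub>i)\<close>. The difference of the two equations kills the
  mixed term; the rest, with \<open>1 - a\<^sup>2 = \<sigma> c\<^sup>2\<close>, compares the diagonal terms.\<close>
lemma exchange_invariance:
  fixes F :: "'v \<Rightarrow> 'v \<Rightarrow> 'u::real_vector"
  assumes F: "bilinear F" "\<And>x y. F x y = F y x"
    and on: "orthonormal_family g I \<epsilon> b" "span (b ` I) = UNIV"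
    and ij: "i \<in> I" "j \<in> I" "i \<noteq> j"
    and inv: "\<And>b'. orthonormal_family g I \<epsilon> b' \<Longrightarrow> span (b' ` I) = UNIV \<Longrightarrow>
      (\<And>k. k \<noteq> i \<Longrightarrow> k \<noteq> j \<Longrightarrow> b' k = b k) \<Longrightarrow> F (b' i) (b' i) = F (b i) (b i)"
  shows "\<epsilon> i *\<^sub>R F (b i) (b i) = \<epsilon> j *\<^sub>R F (b j) (b j)" and "F (b i) (b j) = 0"
proof -
  define \<sigma> where "\<sigma> = \<epsilon> i * \<epsilon> j"
  have ei: "\<epsilon> i = 1 \<or> \<epsilon> i = - 1" and ej: "\<epsilon> j = 1 \<or> \<epsilon> j = - 1"
    using on ij by (auto simp: orthonormal_family_def)
  then have "\<sigma> = 1 \<or> \<sigma> = - 1" by (auto simp: \<sigma>_def)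
  then obtain a c where ac: "a * a + \<sigma> * c * c = 1" "a \<noteq> 0" "c \<noteq> 0"
    by (rule rotation_or_boost_parameters)
  have rot: "F (a *\<^sub>R b i + d *\<^sub>R b j) (a *\<^sub>R b i + d *\<^sub>R b j) = F (b i) (b i)"
    if d: "a * a + \<sigma> * d * d = 1" for d
  proof -
    let ?b = "b(i := a *\<^sub>R b i + d *\<^sub>R b j, j := a *\<^sub>R b j - (\<epsilon> i * \<epsilon> j * d) *\<^sub>R b i)"
    have "F (?b i) (?b i) = F (b i) (b i)"
    proof (rule inv[of ?b])
      show "orthonormal_family g I \<epsilon> ?b"
        by (rule orthonormal_rotate(1)[OF on(1) ij d[unfolded \<sigma>_def]])
      show "span (?b ` I) = UNIV"
        using orthonormal_rotate(2)[OF on(1) ij d[unfolded \<sigma>_def]] on(2) by blast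
    qed auto
    then show ?thesis using ij(3) by simp
  qed
  have expand: "F (a *\<^sub>R b i + d *\<^sub>R b j) (a *\<^sub>R b i + d *\<^sub>R b j) =
      (a * a) *\<^sub>R F (b i) (b i) + (2 * a * d) *\<^sub>R F (b i) (b j) + (d * d) *\<^sub>R F (b j) (b j)" for d
    using F(2)[of "b j" "b i"]
    by (simp add: bilinear_ladd[OF F(1)] bilinear_radd[OF F(1)] bilinear_lmul[OF F(1)]
        bilinear_rmul[OF F(1)] algebra_simps flip: scaleR_2)
  have plus: "(a * a) *\<^sub>R F (b i) (b i) + (2 * a * c) *\<^sub>R F (b i) (b j) + (c * c) *\<^sub>R F (b j) (b j)
      = F (b i) (b i)"
    using rot[of c] ac(1) expand[of c] by simp
  have minus: "(a * a) *\<^sub>R F (b i) (b i) - (2 * a * c) *\<^sub>R F (b i) (b j) + (c * c) *\<^sub>R F (b j) (b j)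
      = F (b i) (b i)"
    using rot[of "- c"] ac(1) expand[of "- c"] by simp
  let ?X = "(a * a) *\<^sub>R F (b i) (b i)" and ?Y = "(c * c) *\<^sub>R F (b j) (b j)"
    and ?Z = "(2 * a * c) *\<^sub>R F (b i) (b j)"
  have "2 *\<^sub>R ?Z = (?X + ?Z + ?Y) - (?X - ?Z + ?Y)" by (simp only: scaleR_2) simp
  also have "\<dots> = 0" unfolding plus minus by simp
  finally show zero: "F (b i) (b j) = 0" using ac by simp
  have "(c * c) *\<^sub>R F (b j) (b j) = (1 - a * a) *\<^sub>R F (b i) (b i)"
    using plus zero by (simp add: algebra_simps)
  also have "1 - a * a = c * c * \<sigma>" using ac(1) by (simp add: algebra_simps)
  finally have "(c * c) *\<^sub>R F (b j) (b j) = (c * c) *\<^sub>R \<sigma> *\<^sub>R F (b i) (b i)" by simp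
  then have "F (b j) (b j) = \<sigma> *\<^sub>R F (b i) (b i)"
    using ac(3) by (subst (asm) scaleR_cancel_left) simp
  then show "\<epsilon> i *\<^sub>R F (b i) (b i) = \<epsilon> j *\<^sub>R F (b j) (b j)"
    using ei ej by (auto simp: \<sigma>_def)
qed

text \<open>Rotating or boosting \<open>b i\<close> with \<open>i \<in> K\<close> against \<open>b j\<close> with \<open>j \<notin> K\<close> changes only the \<open>i\<close>-th term of the
  partial trace, so that term is invariant. As \<open>K\<close> and \<open>I - K\<close> are both nonempty, \<open>exchange_invariance\<close>
  makes all \<open>\<epsilon> i *\<^sub>R F (b i) (b i)\<close> equal, and the full trace makes them zero. The diagonal of \<open>F\<close>
  now vanishes in every orthonormal basis, so \<open>exchange_invariance\<close> applies again, to any two indices, and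
  gives the off-diagonal terms.\<close>
lemma bilinear_vanishes_of_partial_traces:
  fixes F :: "'v \<Rightarrow> 'v \<Rightarrow> 'u::real_vector"
  assumes F: "bilinear F" "\<And>x y. F x y = F y x"
    and b: "orthonormal_family g I \<epsilon> b" "span (b ` I) = UNIV"
    and K: "K \<subset> I" "K \<noteq> {}"
    and partial_trace: "\<And>b. orthonormal_family g I \<epsilon> b \<Longrightarrow> span (b ` I) = UNIV \<Longrightarrow>
      (\<Sum>i\<in>K. \<epsilon> i *\<^sub>R F (b i) (b i)) = 0"
    and full_trace: "\<And>b. orthonormal_family g I \<epsilon> b \<Longrightarrow> span (b ` I) = UNIV \<Longrightarrow>
      (\<Sum>i\<in>I. \<epsilon> i *\<^sub>R F (b i) (b i)) = 0"
  shows "F x y = 0"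
proof -
  have finI: "finite I" using b(1) by (rule orthonormal_familyD)
  have diag: "F (b k) (b k) = 0"
    if b: "orthonormal_family g I \<epsilon> b" "span (b ` I) = UNIV" and k: "k \<in> I" for b k
  proof -
    have eq: "\<epsilon> i *\<^sub>R F (b i) (b i) = \<epsilon> j *\<^sub>R F (b j) (b j)" if i: "i \<in> K" and j: "j \<in> I - K" for i j
    proof (rule exchange_invariance(1)[OF F b])
      show "i \<in> I" "j \<in> I" "i \<noteq> j" using i j K by auto
      fix b' assume b': "orthonormal_family g I \<epsilon> b'" "span (b' ` I) = UNIV"
        "\<And>k. k \<noteq> i \<Longrightarrow> k \<noteq> j \<Longrightarrow> b' k = b k"
      have finK: "finite K" using finI K by (auto intro: finite_subset)
      have "(\<Sum>k\<in>K - {i}. \<epsilon> k *\<^sub>R F (b' k) (b' k)) = (\<Sum>k\<in>K - {i}. \<epsilon> k *\<^sub>R F (b k) (b k))"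
      proof (intro sum.cong refl)
        fix k assume "k \<in> K - {i}"
        then have "k \<noteq> i" "k \<noteq> j" using j by auto
        then show "\<epsilon> k *\<^sub>R F (b' k) (b' k) = \<epsilon> k *\<^sub>R F (b k) (b k)" by (simp add: b'(3))
      qed
      moreover have "\<epsilon> i *\<^sub>R F (b' i) (b' i) + (\<Sum>k\<in>K - {i}. \<epsilon> k *\<^sub>R F (b' k) (b' k)) = 0"
        using partial_trace[OF b'(1,2)] sum.remove[OF finK i, of "\<lambda>k. \<epsilon> k *\<^sub>R F (b' k) (b' k)"] by simp
      moreover have "\<epsilon> i *\<^sub>R F (b i) (b i) + (\<Sum>k\<in>K - {i}. \<epsilon> k *\<^sub>R F (b k) (b k)) = 0"
        using partial_trace[OF b] sum.remove[OF finK i, of "\<lambda>k. \<epsilon> k *\<^sub>R F (b k) (b k)"] by simp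
      ultimately have "\<epsilon> i *\<^sub>R F (b' i) (b' i) = \<epsilon> i *\<^sub>R F (b i) (b i)"
        by (metis add_right_cancel)
      then show "F (b' i) (b' i) = F (b i) (b i)"
        using orthonormal_familyD(3)[OF b(1), of i] i K by auto
    qed
    obtain i0 j0 where i0: "i0 \<in> K" and j0: "j0 \<in> I - K" using K by blast
    have const: "\<epsilon> l *\<^sub>R F (b l) (b l) = \<epsilon> i0 *\<^sub>R F (b i0) (b i0)" if "l \<in> I" for l
      using eq[OF i0 j0] eq[of l j0] eq[OF i0, of l] j0 that by (cases "l \<in> K") auto
    have "0 = (\<Sum>l\<in>I. \<epsilon> l *\<^sub>R F (b l) (b l))" using full_trace[OF b] by simp
    also have "\<dots> = (\<Sum>l\<in>I. \<epsilon> i0 *\<^sub>R F (b i0) (b i0))" using const by (intro sum.cong) auto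
    also have "\<dots> = real (card I) *\<^sub>R \<epsilon> i0 *\<^sub>R F (b i0) (b i0)" by (rule sum_constant_scaleR)
    finally have "\<epsilon> i0 *\<^sub>R F (b i0) (b i0) = 0" using finI k by auto
    then have "\<epsilon> k *\<^sub>R F (b k) (b k) = 0" using const[OF k] by simp
    then show ?thesis using orthonormal_familyD(3)[OF b(1) k] by simp
  qed
  have offdiag: "F (b i) (b j) = 0" if "i \<in> I" "j \<in> I" for i j
  proof (cases "i = j")
    case True
    then show ?thesis using diag[OF b] that by simp
  next
    case False
    show ?thesis
      by (rule exchange_invariance(2)[OF F b that False]) (simp add: diag[OF _ _ that(1)] diag[OF b that(1)])
  qed
  have "bilinear (\<lambda>x y :: 'v. 0 :: 'u)" by (simp add: bilinear_def linear_zero)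
  from bilinear_eq[OF F(1) this, of UNIV "b ` I" UNIV "b ` I" x y]
  show ?thesis using offdiag b(2) by auto
qed

end

section \<open>Higher order Jacobi operators\<close>
sublocale zero_model \<subseteq> symmetric_form g
  using bilinear_g symmetric_g by unfold_locales

context zero_model
begin

lemma form_ext: "(\<And>z. g x z = g y z) \<Longrightarrow> x = y"
  using nondegenerate_g form_simps(3)[of x y] by (auto simp: nondegenerate_on_def dest: spec[of _ "x - y"])

text \<open>The definite description in \<open>curvature_operator\<close> denotes: a non-degenerate form represents every
  linear functional, with coefficients read off in an orthonormal basis, by exactly one vector.\<close>
lemma form_curvature_operator: "g (curvature_operator g A v1 v2 v3) v4 = A v1 v2 v3 v4"
proof -
  obtain C :: "'v set" where C: "finite C" "span C = UNIV" using finite_dimensional by blast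
  obtain S where S: "orthonormal_family g S (\<lambda>x. g x x) (\<lambda>x. x)" "span S = UNIV"
    using orthonormal_basis_exists[OF C subspace_UNIV nondegenerate_g] .
  interpret A4: linear "A v1 v2 v3" by (rule linear_A4)
  define w where "w = (\<Sum>i\<in>S. (g i i * A v1 v2 v3 i) *\<^sub>R i)"
  have w: "g w x = A v1 v2 v3 x" for x
  proof -
    have "A v1 v2 v3 x = A v1 v2 v3 (\<Sum>i\<in>S. (g i i * g x i) *\<^sub>R i)"
      using orthonormal_expansion[OF S(1), of x] S(2) by simp
    also have "\<dots> = (\<Sum>i\<in>S. (g i i * g x i) * A v1 v2 v3 i)"
      by (simp add: A4.sum A4.scale)
    also have "\<dots> = g w x"
      unfolding w_def form_sum form_simps
      by (intro sum.cong refl) (simp add: symmetric_g[of x] mult_ac)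
    finally show ?thesis by simp
  qed
  have "\<exists>!w. \<forall>x. g w x = A v1 v2 v3 x"
    using w form_ext by metis
  from theI'[OF this] show ?thesis unfolding curvature_operator_def by blast
qed

lemma form_jacobi_polarized:
  "g (jacobi_polarized g A x y w) z = (A w x y z + A w y x z) / 2"
  by (simp add: jacobi_polarized_def form_simps form_curvature_operator)

lemma jacobi_polarized_sym: "jacobi_polarized g A x y w = jacobi_polarized g A y x w"
  by (simp add: jacobi_polarized_def add.commute)

lemma bilinear_jacobi_polarized: "bilinear (\<lambda>x y. jacobi_polarized g A x y w)"
  unfolding bilinear_def
  by (intro conjI allI linearI form_ext)
     (simp_all add: form_jacobi_polarized form_simps linear_add[OF linear_A2] linear_add[OF linear_A3]
       linear_scale[OF linear_A2] linear_scale[OF linear_A3] field_simps)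

lemma linear_jacobi_polarized: "linear (jacobi_polarized g A x y)"
  by (intro linearI form_ext)
     (simp_all add: form_jacobi_polarized form_simps linear_add[OF linear_A1]
       linear_scale[OF linear_A1] field_simps)

lemma higher_jacobi_orthonormal:
  assumes on: "orthonormal_family g I \<epsilon> b"
  shows "higher_jacobi g A (span (b ` I)) w =
    (\<Sum>i\<in>I. \<epsilon> i *\<^sub>R jacobi_polarized g A (b i) (b i) w)"
proof -
  define B where "B = (SOME B. finite B \<and> independent B \<and> span B = span (b ` I))"
  have "finite B \<and> independent B \<and> span B = span (b ` I)"
    unfolding B_def
    by (rule someI[of _ "b ` I"])
       (use orthonormal_familyD(1)[OF on] orthonormal_independent[OF on] in auto)
  then show ?thesis
    using gram_trace_orthonormal[OF bilinear_jacobi_polarized on, of B w]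
    by (simp add: higher_jacobi_def higher_jacobi_basis_def B_def)
qed

lemma linear_higher_jacobi: "linear (higher_jacobi g A W)"
  unfolding higher_jacobi_def higher_jacobi_basis_def
  by (intro linearI)
     (simp_all add: linear_add[OF linear_jacobi_polarized] linear_scale[OF linear_jacobi_polarized]
       algebra_simps sum.distrib scaleR_sum_right)

lemma higher_jacobi_complement:
  assumes "W \<in> nondegenerate_subspaces g"
  shows "higher_jacobi g A W w + higher_jacobi g A (orth_compl g W) w = ricci_operator g A w"
proof -
  obtain C :: "'v set" where C: "finite C" "span C = UNIV" using finite_dimensional by blast
  obtain S T where ST: "orthonormal_family g (S \<union> T) (\<lambda>x. g x x) (\<lambda>x. x)" "S \<inter> T = {}"
    "span S = W" "span T = orth_compl g W" "span (S \<union> T) = UNIV"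
    using adapted_orthonormal_basis[OF C nondegenerate_g assms] .
  have "finite S" "finite T" using orthonormal_familyD(1)[OF ST(1)] by auto
  moreover have "orthonormal_family g S (\<lambda>x. g x x) (\<lambda>x. x)" "orthonormal_family g T (\<lambda>x. g x x) (\<lambda>x. x)"
    using orthonormal_family_subset[OF ST(1)] by auto
  ultimately show ?thesis
    using higher_jacobi_orthonormal[of S "\<lambda>x. g x x" "\<lambda>x. x" w]
      higher_jacobi_orthonormal[of T "\<lambda>x. g x x" "\<lambda>x. x" w]
      higher_jacobi_orthonormal[OF ST(1), of w] ST(2-5)
    by (simp add: ricci_operator_def sum.union_disjoint)
qed

lemma commute_complement_iff_commute_ricci:
  assumes W: "W \<in> nondegenerate_subspaces g"
  shows "higher_jacobi g A W \<circ> higher_jacobi g A (orth_compl g W) =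
      higher_jacobi g A (orth_compl g W) \<circ> higher_jacobi g A W \<longleftrightarrow>
    commutator (higher_jacobi g A W) (ricci_operator g A) = (\<lambda>x. 0)"
proof -
  have compl: "higher_jacobi g A (orth_compl g W) w = ricci_operator g A w - higher_jacobi g A W w" for w
    using higher_jacobi_complement[OF W, of w] by (simp add: algebra_simps)
  show ?thesis
    by (simp add: fun_eq_iff commutator_def compl linear_diff[OF linear_higher_jacobi])
qed

section \<open>Commutation with the Ricci operator\<close>
lemma span_orthonormal_in_Gr:
  assumes on: "orthonormal_family g I \<epsilon> b"
    and r: "card {i \<in> I. \<epsilon> i = - 1} = r" and s: "card {i \<in> I. \<epsilon> i = 1} = s"
  shows "span (b ` I) \<in> Gr g r s"
proof -
  let ?N = "{i \<in> I. \<epsilon> i = - 1}" and ?P = "{i \<in> I. \<epsilon> i = 1}"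
  have inj: "inj_on b I" by (rule orthonormal_inj[OF on])
  have I: "I = ?N \<union> ?P" using on by (auto simp: orthonormal_family_def)
  have un: "b ` ?N \<union> b ` ?P = b ` I" using I by blast
  \<comment> \<open>a vector orthogonal to the family has all coefficients zero in its orthonormal expansion\<close>
  have nd: "nondegenerate_on g (span (b ` I))"
    unfolding nondegenerate_on_def
  proof (intro ballI impI)
    fix x assume x: "x \<in> span (b ` I)" "\<forall>y\<in>span (b ` I). g x y = 0"
    then have "(\<Sum>i\<in>I. (\<epsilon> i * g x (b i)) *\<^sub>R b i) = 0"
      by (intro sum.neutral) (auto simp: span_base)
    then show "x = 0" using orthonormal_expansion[OF on x(1)] by simp
  qed
  have "has_signature g (span (b ` I)) r s"
    unfolding has_signature_def
  proof (rule exI[of _ "b ` ?N"], rule exI[of _ "b ` ?P"], intro conjI)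
    show "finite (b ` ?N)" "finite (b ` ?P)" using orthonormal_familyD(1)[OF on] by auto
    show "b ` ?N \<inter> b ` ?P = {}"
      using inj_on_image_Int[OF inj, of ?N ?P] by auto
    show "card (b ` ?N) = r" "card (b ` ?P) = s"
      using r s inj by (auto simp: card_image inj_on_subset)
    show "independent (b ` ?N \<union> b ` ?P)" unfolding un by (rule orthonormal_independent[OF on])
    show "span (b ` ?N \<union> b ` ?P) = span (b ` I)" unfolding un ..
    show "\<forall>x\<in>b ` ?N. g x x = - 1" "\<forall>x\<in>b ` ?P. g x x = 1"
      using orthonormal_familyD(4)[OF on] by auto
    show "\<forall>x\<in>b ` ?N \<union> b ` ?P. \<forall>y\<in>b ` ?N \<union> b ` ?P. x \<noteq> y \<longrightarrow> g x y = 0"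
      unfolding un using orthonormal_familyD(4)[OF on] by auto
  qed
  with nd show ?thesis by (auto simp: Gr_def nondegenerate_subspaces_def)
qed

text \<open>Start from the orthonormal basis \<open>T \<union> S\<close> behind the signature of \<open>V\<close> and fix index sets
  \<open>T0 \<subseteq> T\<close>, \<open>S0 \<subseteq> S\<close> of sizes \<open>r\<close>, \<open>s\<close>. In every orthonormal basis with the same signs, the vectors
  indexed by \<open>T0 \<union> S0\<close> span a member of \<open>Gr g r s\<close>, so the partial traces of \<open>F\<close> vanish;
  the full trace is the commutator of the Ricci operator with itself. Admissibility says
  precisely that \<open>T0 \<union> S0\<close> is nonempty and not everything.\<close>
lemma jacobi_commutes_ricci:
  assumes adm: "admissible p q r s"
    and comm: "\<And>W. W \<in> Gr g r s \<Longrightarrow>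
      commutator (higher_jacobi g A W) (ricci_operator g A) = (\<lambda>x. 0)"
  shows "jacobi_polarized g A x y (ricci_operator g A w) =
    ricci_operator g A (jacobi_polarized g A x y w)"
proof -
  let ?\<rho> = "ricci_operator g A" and ?\<epsilon> = "\<lambda>x. g x x"
  define F where "F x y = jacobi_polarized g A x y (?\<rho> w) - ?\<rho> (jacobi_polarized g A x y w)" for x y
  have lin_ricci: "linear ?\<rho>" unfolding ricci_operator_def by (rule linear_higher_jacobi)
  note jac = bilinear_jacobi_polarized
  have F: "bilinear F"
    unfolding bilinear_def F_def
    by (intro conjI allI linearI)
       (simp_all add: bilinear_ladd[OF jac] bilinear_radd[OF jac] bilinear_lmul[OF jac]
         bilinear_rmul[OF jac] linear_add[OF lin_ricci] linear_scale[OF lin_ricci] algebra_simps)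
  have Fsym: "F x y = F y x" for x y by (simp add: F_def jacobi_polarized_sym[of x y])
  obtain T S where TS: "finite T" "finite S" "T \<inter> S = {}" "card T = p" "card S = q"
    "independent (T \<union> S)" "span (T \<union> S) = UNIV" "\<forall>x\<in>T. g x x = - 1" "\<forall>x\<in>S. g x x = 1"
    "\<forall>x\<in>T \<union> S. \<forall>y\<in>T \<union> S. x \<noteq> y \<longrightarrow> g x y = 0"
    using signature_g unfolding has_signature_def by (elim exE conjE) (rule that)
  have on: "orthonormal_family g (T \<union> S) ?\<epsilon> (\<lambda>x. x)"
    unfolding orthonormal_family_def
  proof (intro conjI ballI)
    show "finite (T \<union> S)" using TS by simp
    show "g x x = 1 \<or> g x x = - 1" if "x \<in> T \<union> S" for x using that TS(8,9) by blast
    show "g x y = (if x = y then g x x else 0)" if "x \<in> T \<union> S" "y \<in> T \<union> S" for x y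
      using that TS(10) by simp
  qed
  have "r \<le> card T" "s \<le> card S" using adm TS(4,5) by (auto simp: admissible_def)
  then obtain T0 S0 where T0: "T0 \<subseteq> T" "card T0 = r" and S0: "S0 \<subseteq> S" "card S0 = s"
    using obtain_subset_with_card_n[of r T] obtain_subset_with_card_n[of s S] by metis
  let ?K = "T0 \<union> S0"
  have cardK: "card ?K = r + s"
    using T0 S0 TS(1-3) by (subst card_Un_disjoint) (auto intro: finite_subset)
  have cardI: "card (T \<union> S) = p + q" using TS by (simp add: card_Un_disjoint)
  have K: "?K \<subset> T \<union> S" "?K \<noteq> {}"
    using T0 S0 cardK cardI adm by (auto simp: admissible_def)
  have trace: "(\<Sum>i\<in>J. ?\<epsilon> i *\<^sub>R F (b i) (b i)) = commutator (higher_jacobi g A (span (b ` J))) ?\<rho> w"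
    if "orthonormal_family g J ?\<epsilon> b" for J and b :: "'v \<Rightarrow> 'v"
    by (simp add: F_def commutator_def higher_jacobi_orthonormal[OF that] linear_sum[OF lin_ricci]
        linear_scale[OF lin_ricci] scaleR_diff_right sum_subtractf)
  have "F x y = 0"
  proof (rule bilinear_vanishes_of_partial_traces[OF F Fsym on _ K])
    show "span ((\<lambda>x. x) ` (T \<union> S)) = UNIV" using TS(7) by simp
  next
    fix b assume b: "orthonormal_family g (T \<union> S) ?\<epsilon> b"
    have on_K: "orthonormal_family g ?K ?\<epsilon> b"
      by (rule orthonormal_family_subset[OF b]) (use K in auto)
    have "{i \<in> ?K. ?\<epsilon> i = - 1} = T0" "{i \<in> ?K. ?\<epsilon> i = 1} = S0"
      using T0 S0 TS(8,9) by force+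
    then have "span (b ` ?K) \<in> Gr g r s"
      using span_orthonormal_in_Gr[OF on_K] T0 S0 by simp
    then show "(\<Sum>i\<in>?K. ?\<epsilon> i *\<^sub>R F (b i) (b i)) = 0"
      using trace[OF on_K] comm by simp
  next
    fix b assume b: "orthonormal_family g (T \<union> S) ?\<epsilon> b" "span (b ` (T \<union> S)) = UNIV"
    then show "(\<Sum>i\<in>T \<union> S. ?\<epsilon> i *\<^sub>R F (b i) (b i)) = 0"
      using trace[OF b(1)] by (simp add: commutator_def ricci_operator_def)
  qed
  then show ?thesis by (simp add: F_def)
qed

lemma commutator_ricci_zero:
  assumes W: "W \<in> nondegenerate_subspaces g"
    and comm: "\<And>x y w. jacobi_polarized g A x y (ricci_operator g A w) =
      ricci_operator g A (jacobi_polarized g A x y w)"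
  shows "commutator (higher_jacobi g A W) (ricci_operator g A) = (\<lambda>x. 0)"
proof -
  have lin_ricci: "linear (ricci_operator g A)"
    unfolding ricci_operator_def by (rule linear_higher_jacobi)
  show ?thesis
    by (simp add: fun_eq_iff commutator_def higher_jacobi_def higher_jacobi_basis_def comm
        linear_sum[OF lin_ricci] linear_scale[OF lin_ricci])
qed

end

theorem theorem1p1:
  fixes g :: "'v::real_vector \<Rightarrow> 'v \<Rightarrow> real"
    and A :: "'v \<Rightarrow> 'v \<Rightarrow> 'v \<Rightarrow> 'v \<Rightarrow> real"
    and p q :: nat
  assumes "zero_model g A p q"
    and "2 \<le> p + q"
  defines "assertion1 \<equiv> (\<exists>r0 s0. admissible p q r0 s0 \<and>
             (\<forall>W\<in>Gr g r0 s0.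
                higher_jacobi g A W \<circ> higher_jacobi g A (orth_compl g W) =
                higher_jacobi g A (orth_compl g W) \<circ> higher_jacobi g A W))"
    and "assertion2 \<equiv> (\<forall>W\<in>nondegenerate_subspaces g.
             higher_jacobi g A W \<circ> higher_jacobi g A (orth_compl g W) =
             higher_jacobi g A (orth_compl g W) \<circ> higher_jacobi g A W)"
    and "assertion3 \<equiv> (\<forall>W\<in>nondegenerate_subspaces g.
             commutator (higher_jacobi g A W) (ricci_operator g A) = (\<lambda>x. 0))"
  shows "(assertion1 \<longleftrightarrow> assertion2) \<and> (assertion2 \<longleftrightarrow> assertion3)"
proof -
  interpret zero_model g A p q by (rule assms(1))
  have Gr_nd: "W \<in> nondegenerate_subspaces g" if "W \<in> Gr g r s" for W r s
    using that by (simp add: Gr_def)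
  have iff23: "assertion2 \<longleftrightarrow> assertion3"
    unfolding assertion2_def assertion3_def using commute_complement_iff_commute_ricci by blast
  have "assertion1" if a2: assertion2
  proof -
    \<comment> \<open>a single unit vector spans a proper subspace since \<open>V\<close> has dimension at least two; it is timelike
      if there are timelike directions and spacelike otherwise\<close>
    have "admissible p q (if 1 \<le> p then 1 else 0) (if 1 \<le> p then 0 else 1)"
      using assms(2) by (auto simp: admissible_def)
    then show ?thesis using a2 Gr_nd unfolding assertion1_def assertion2_def by blast
  qed
  moreover have "assertion3" if a1: assertion1
  proof -
    obtain r s where adm: "admissible p q r s" and Gr: "\<And>W. W \<in> Gr g r s \<Longrightarrow>
        higher_jacobi g A W \<circ> higher_jacobi g A (orth_compl g W) =
        higher_jacobi g A (orth_compl g W) \<circ> higher_jacobi g A W"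
      using a1 unfolding assertion1_def by blast
    have "commutator (higher_jacobi g A W) (ricci_operator g A) = (\<lambda>x. 0)" if "W \<in> Gr g r s" for W
      using Gr[OF that] commute_complement_iff_commute_ricci[OF Gr_nd[OF that]] by blast
    from jacobi_commutes_ricci[OF adm this]
    show ?thesis unfolding assertion3_def using commutator_ricci_zero by blast
  qed
  ultimately show ?thesis using iff23 by blast
qed

end
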